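(* Let $\mathbb{F}$ be an infinite field of characteristic different from $2$, let $k\ge 1$, and let $G$ be a $k$-path on $n$ vertices. Then $mr^{-}(\mathbb{F},G)=n-k$ if $n-k$ is even, and $mr^{-}(\mathbb{F},G)=n-k+1$ if $n-k$ is odd.
   Context: All graphs are finite and simple. For a field $\mathbb{F}$ and a graph $G$ on vertices $v_1,\dots,v_n$, $S^{-}(\mathbb{F},G)$ is the set of skew-symmetric matrices $A\in\mathbb{F}^{n\times n}$ such that for $i\neq j$, $a_{ij}\neq0$ iff $v_iv_j$ is an edge; $mr^{-}(\mathbb{F},G)=\min\{\operatorname{rank}A: A\in S^{-}(\mathbb{F},G)\}$. $k$-trees are defined recursively: $K_{k+1}$ is a $k$-tree; a $k$-tree on $n+1$ vertices ($n\ge k+1$) is obtained from a $k$-tree $H$ on $n$ vertices by adding a vertex adjacent to all vertices of a $k$-clique of $H$. A $k$-path is a $k$-tree that is either $K_{k+1}$ or has exactly two vertices of degree $k$. *)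

theory Defs
  imports
    "Jordan_Normal_Form.DL_Rank"
    "Graph_Theory.Kuratowski"
begin

text \<open>
  A finite simple graph is a \<^locale>\<open>pair_graph\<close>: the arc set is a finite, irreflexive,
  symmetric relation on the finite vertex set, so an edge is a pair of opposite arcs and
  the degree of a vertex is its out-degree.
\<close>

definition clique :: "'v pair_pre_digraph \<Rightarrow> 'v set \<Rightarrow> bool" where
  "clique G C \<longleftrightarrow> C \<subseteq> pverts G \<and> (\<forall>u\<in>C. \<forall>w\<in>C. u \<noteq> w \<longrightarrow> (u, w) \<in> parcs G)"

definition join_vertex :: "'v pair_pre_digraph \<Rightarrow> 'v \<Rightarrow> 'v set \<Rightarrow> 'v pair_pre_digraph" where
  "join_vertex H v C =
     \<lparr>pverts = insert v (pverts H), parcs = parcs H \<union> {v} \<times> C \<union> C \<times> {v}\<rparr>"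

inductive k_tree :: "nat \<Rightarrow> 'v pair_pre_digraph \<Rightarrow> bool" for k where
  complete: "K\<^bsub>k + 1\<^esub> (with_proj G) \<Longrightarrow> k_tree k G"
| join: "k_tree k H \<Longrightarrow> v \<notin> pverts H \<Longrightarrow> clique H C \<Longrightarrow> card C = k
    \<Longrightarrow> k_tree k (join_vertex H v C)"

definition k_path :: "nat \<Rightarrow> 'v pair_pre_digraph \<Rightarrow> bool" where
  "k_path k G \<longleftrightarrow> k_tree k G \<and>
     (K\<^bsub>k + 1\<^esub> (with_proj G) \<or> card {v \<in> pverts G. out_degree (with_proj G) v = k} = 2)"

text \<open>
  The list \<open>vs\<close> is the enumeration \<open>v\<^sub>1, \<dots>, v\<^sub>n\<close> of the vertices that indexes rows and columns
  (starting from 0); it is meant to be a distinct list with \<open>set vs = pverts G\<close>.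
\<close>

definition S_minus :: "'v pair_pre_digraph \<Rightarrow> 'v list \<Rightarrow> 'a :: field mat set" where
  "S_minus G vs =
     {A \<in> carrier_mat (length vs) (length vs). transpose_mat A = - A \<and>
        (\<forall>i < length vs. \<forall>j < length vs. i \<noteq> j \<longrightarrow>
           (A $$ (i, j) \<noteq> 0 \<longleftrightarrow> (vs ! i, vs ! j) \<in> parcs G))}"

definition mr_minus :: "'a :: field itself \<Rightarrow> 'v pair_pre_digraph \<Rightarrow> 'v list \<Rightarrow> nat" where
  "mr_minus _ G vs = Min (vec_space.rank (length vs) ` (S_minus G vs :: 'a mat set))"

end

theory Submission
  imports Defs
begin

text \<open>
  A \<open>k\<close>-path on \<open>n = k + m\<close> vertices is a sequence of \<open>m\<close> cliques of size \<open>k + 1\<close>, each obtained from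
  the previous one by replacing a vertex other than the newest one. Let \<open>g t\<close> be the newest
  vertex of the \<open>t\<close>-th clique and \<open>f t\<close> the vertex dropped from it. Then \<open>f t\<close> is adjacent to \<open>g t\<close>
  but to no later \<open>g s\<close>, so rows \<open>f\<close> and columns \<open>g\<close> give a triangular submatrix of size \<open>m\<close> and every
  matrix of the graph has rank at least \<open>m\<close>. As skew-symmetric matrices have even rank, the
  rank is at least \<open>2 \<lceil>m/2\<rceil>\<close>. Conversely, vectors in a symplectic space of dimension
  \<open>2 \<lceil>m/2\<rceil>\<close> whose non-orthogonality graph is the given one are constructed by adding a
  hyperbolic plane for every two new vertices.
\<close>

section \<open>Neighbourhoods and degrees when a vertex is joined\<close>

definition nb :: "'v pair_pre_digraph \<Rightarrow> 'v \<Rightarrow> 'v set" where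
  "nb G v = parcs G `` {v}"

lemma out_degree_eq_card_nb: "out_degree (with_proj G) v = card (nb G v)"
proof -
  have "out_arcs (with_proj G) v = Pair v ` nb G v"
    by (auto simp: out_arcs_def nb_def)
  then show ?thesis
    by (simp add: out_degree_def card_image inj_on_def)
qed

lemma join_vertex_simps [simp]:
  "pverts (join_vertex H v C) = insert v (pverts H)"
  "parcs (join_vertex H v C) = parcs H \<union> {v} \<times> C \<union> C \<times> {v}"
  by (simp_all add: join_vertex_def)

lemma pair_graph_join_vertex:
  assumes "pair_graph H" "v \<notin> pverts H" "C \<subseteq> pverts H"
  shows "pair_graph (join_vertex H v C)"
proof -
  interpret pair_graph H by fact
  have "finite C" using assms(3) pair_finite_verts finite_subset by blast
  moreover have "sym (parcs H)" using pair_sym_arcs by (simp add: symmetric_def)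
  ultimately show ?thesis
    using assms pair_finite_verts pair_finite_arcs
    by unfold_locales (auto dest: wellformed' pair_no_loops simp: symmetric_def sym_def)
qed

lemma k_tree_pair_graph: "k_tree k G \<Longrightarrow> pair_graph G"
  by (induction rule: k_tree.induct)
    (auto intro: pair_graphI_complete pair_graph_join_vertex simp: clique_def)

context pair_graph
begin

lemma nb_subset: "nb G v \<subseteq> pverts G"
  using wellformed' by (auto simp: nb_def)

lemma finite_nb: "finite (nb G v)"
  using nb_subset pair_finite_verts finite_subset by blast

lemma arc_sym: "(u, v) \<in> parcs G \<Longrightarrow> (v, u) \<in> parcs G"
  using pair_sym_arcs by (auto simp: symmetric_def sym_def)

lemma arc_irrefl: "(u, u) \<notin> parcs G"
  using pair_no_loops by fastforce

lemma nb_join_vertex: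
  assumes "v \<notin> pverts G" "C \<subseteq> pverts G"
  shows "nb (join_vertex G v C) x =
    (if x = v then C else if x \<in> C then insert v (nb G x) else nb G x)"
  using assms wellformed' by (auto simp: nb_def)

lemma card_nb_join_vertex:
  assumes "v \<notin> pverts G" "C \<subseteq> pverts G"
  shows "card (nb (join_vertex G v C) x) =
    (if x = v then card C else if x \<in> C then Suc (card (nb G x)) else card (nb G x))"
proof -
  have "v \<notin> nb G x" using nb_subset assms by blast
  then show ?thesis using assms finite_nb by (simp add: nb_join_vertex)
qed

end

lemma nb_complete:
  assumes "K\<^bsub>n\<^esub> (with_proj G)" "v \<in> pverts G"
  shows "nb G v = pverts G - {v}"
  using assms by (auto simp: complete_digraph_pair_def nb_def)

lemma card_nb_complete:
  assumes "K\<^bsub>k + 1\<^esub> (with_proj G)" "v \<in> pverts G"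
  shows "card (nb G v) = k"
  using nb_complete[OF assms] assms by (auto simp: complete_digraph_pair_def)

section \<open>Vertices of degree k in k-trees\<close>

lemma k_tree_degree_ge: "k_tree k G \<Longrightarrow> v \<in> pverts G \<Longrightarrow> k \<le> card (nb G v)"
proof (induction arbitrary: v rule: k_tree.induct)
  case (complete G)
  then show ?case by (simp add: card_nb_complete)
next
  case (join H w C)
  then interpret pair_graph H by (simp add: k_tree_pair_graph)
  have "C \<subseteq> pverts H" using join by (simp add: clique_def)
  then show ?case using join.IH[of v] join by (auto simp: card_nb_join_vertex intro: le_SucI)
qed

text \<open>The joined vertex has all its neighbours in \<open>C\<close>, and vertices of
  \<open>C\<close> end with degree above \<open>k\<close>. So an adjacent pair of degree
  \<open>k\<close> would already be one in \<open>H\<close>, outside \<open>C\<close>.\<close>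

lemma k_tree_degree_k_nonadjacent:
  assumes "k_tree k G" "\<not> K\<^bsub>k + 1\<^esub> (with_proj G)"
    "card (nb G x) = k" "card (nb G y) = k" "(x, y) \<in> parcs G"
  shows False
  using assms
proof (induction rule: k_tree.induct)
  case (join H v C)
  then interpret pair_graph H by (simp add: k_tree_pair_graph)
  have C: "C \<subseteq> pverts H" using join by (simp add: clique_def)
  have ge: "z \<in> C \<Longrightarrow> k < card (nb (join_vertex H v C) z)" for z
    using C join k_tree_degree_ge[of k H z] by (auto simp: card_nb_join_vertex)
  then have nC: "x \<notin> C" "y \<notin> C" using join.prems(2,3) by fastforce+
  then have xy: "(x, y) \<in> parcs H" using join.prems(4) by simp
  then have V: "x \<in> pverts H" "y \<in> pverts H" "x \<noteq> y"
    using wellformed' arc_irrefl by auto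
  then have "card (nb H x) = k" "card (nb H y) = k"
    using join C nC by (auto simp: card_nb_join_vertex split: if_splits)
  then show ?case
  proof (cases "K\<^bsub>k + 1\<^esub> (with_proj H)")
    case True
    \<comment> \<open>No induction hypothesis applies to a complete \<open>H\<close>; instead
      \<open>C\<close>, \<open>x\<close> and \<open>y\<close> would be \<open>k + 2\<close> vertices
      among \<open>k + 1\<close>.\<close>
    then have "card (C \<union> {x, y}) \<le> k + 1"
      using card_mono[of "pverts H" "C \<union> {x, y}"] V C by (auto simp: complete_digraph_pair_def)
    moreover have "card (C \<union> {x, y}) = k + 2"
      using nC V C join pair_finite_verts finite_subset[of C] by (subst card_Un_disjoint) auto
    ultimately show False by simp
  next
    case False
    then show False using join.IH xy \<open>card (nb H x) = k\<close> \<open>card (nb H y) = k\<close> by blast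
  qed
qed simp

text \<open>The newest vertex is one. Another survives from \<open>H\<close> outside
  \<open>C\<close>: degree-\<open>k\<close> vertices of a non-complete \<open>H\<close> are
  non-adjacent, so the clique \<open>C\<close> cannot contain two of them.\<close>

lemma k_tree_two_degree_k:
  assumes "k_tree k G" "1 \<le> k"
  shows "\<exists>x\<in>pverts G. \<exists>y\<in>pverts G. x \<noteq> y \<and> card (nb G x) = k \<and> card (nb G y) = k"
  using assms
proof (induction rule: k_tree.induct)
  case (complete G)
  then have "\<not> card (pverts G) \<le> Suc 0" "finite (pverts G)"
    by (auto simp: complete_digraph_pair_def)
  then obtain x y where "x \<in> pverts G" "y \<in> pverts G" "x \<noteq> y"
    using card_le_Suc0_iff_eq[of "pverts G"] by blast
  moreover from this have "card (nb G x) = k" "card (nb G y) = k"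
    using card_nb_complete[OF complete(1)] by simp_all
  ultimately show ?case by - (rule bexI[of _ x], rule bexI[of _ y], simp_all)
next
  case (join H v C)
  then interpret pair_graph H by (simp add: k_tree_pair_graph)
  have C: "C \<subseteq> pverts H" using join by (simp add: clique_def)
  have "\<exists>x\<in>pverts H - C. card (nb H x) = k"
  proof (cases "K\<^bsub>k + 1\<^esub> (with_proj H)")
    case True
    then have "card (pverts H) \<noteq> card C" using join.hyps(4) by (simp add: complete_digraph_pair_def)
    then have "C \<noteq> pverts H" by auto
    then obtain x where "x \<in> pverts H - C" using C by blast
    then show ?thesis using card_nb_complete[OF True, of x] by (intro bexI[of _ x]) auto
  next
    case False
    obtain x y where xy: "x \<in> pverts H" "y \<in> pverts H" "x \<noteq> y"
      "card (nb H x) = k" "card (nb H y) = k"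
      using join.IH[OF join.prems] by (elim bexE conjE)
    have "(x, y) \<notin> parcs H"
      using k_tree_degree_k_nonadjacent[OF join.hyps(1) False xy(4,5)] by (rule notI)
    then have "x \<notin> C \<or> y \<notin> C" using join.hyps(3) xy(3) by (auto simp: clique_def)
    then show ?thesis using bexI[of _ x] bexI[of _ y] xy by (elim disjE) simp_all
  qed
  then obtain x where "x \<in> pverts H - C" "card (nb H x) = k" by (elim bexE)
  then have "v \<noteq> x" "card (nb (join_vertex H v C) v) = k" "card (nb (join_vertex H v C) x) = k"
    using join.hyps(2,4) C by (auto simp: card_nb_join_vertex)
  moreover have "v \<in> pverts (join_vertex H v C)" "x \<in> pverts (join_vertex H v C)"
    using \<open>x \<in> pverts H - C\<close> by simp_all
  ultimately show ?case by - (rule bexI[of _ v], rule bexI[of _ x], simp_all)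
qed

text \<open>Lets \<open>k_path_imp_seq\<close> remove a prescribed degree-\<open>k\<close> vertex,
  not just the one that the recursion happened to add last.\<close>

lemma k_tree_peel:
  assumes "k_tree k G" "\<not> K\<^bsub>k + 1\<^esub> (with_proj G)" "w \<in> pverts G" "card (nb G w) = k"
  shows "\<exists>H C. k_tree k H \<and> w \<notin> pverts H \<and> clique H C \<and> card C = k \<and> G = join_vertex H w C"
  using assms
proof (induction rule: k_tree.induct)
  case (join H v C)
  then interpret pair_graph H by (simp add: k_tree_pair_graph)
  have C: "C \<subseteq> pverts H" using join by (simp add: clique_def)
  show ?case
  proof (cases "w = v")
    case True
    then show ?thesis using join.hyps by metis
  next
    case wv: False
    then have w: "w \<in> pverts H" using join by simp
    then have wC: "w \<notin> C" "card (nb H w) = k"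
      using k_tree_degree_ge[OF join.hyps(1) w] join.prems join.hyps C wv
      by (auto simp: card_nb_join_vertex split: if_splits)
    show ?thesis
    proof (cases "K\<^bsub>k + 1\<^esub> (with_proj H)")
      case True
      then have fin: "finite (pverts H)" and cH: "card (pverts H) = k + 1"
        and pH: "parcs H = {(u, v). u \<in> pverts H \<and> v \<in> pverts H \<and> u \<noteq> v}"
        by (auto simp: complete_digraph_pair_def)
      \<comment> \<open>Here \<open>v\<close> and \<open>w\<close> both have neighbourhood
        \<open>C\<close>, so they trade places: \<open>w\<close> is joined to the complete graph
        \<open>H'\<close> on \<open>C\<close> and \<open>v\<close>.\<close>
      have "C = pverts H - {w}"
        using C wC fin cH join.hyps w by (intro card_subset_eq) auto
      then have V: "pverts H = insert w C" using w by auto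
      have finC: "finite C" using fin V by simp
      have "v \<notin> C" using C join.hyps by blast
      define H' where "H' = \<lparr>pverts = insert v C, parcs = {(x, y). x \<in> insert v C \<and> y \<in> insert v C \<and> x \<noteq> y}\<rparr>"
      have "K\<^bsub>k + 1\<^esub> (with_proj H')"
        using finC join.hyps(4) \<open>v \<notin> C\<close> by (auto simp: complete_digraph_pair_def H'_def)
      then have "k_tree k H'" by (rule k_tree.complete)
      moreover have "join_vertex H v C = join_vertex H' w C"
        using V wC wv join.hyps by (auto simp: join_vertex_def H'_def pH)
      moreover have "w \<notin> pverts H'" "clique H' C" "card C = k"
        using wC wv join.hyps by (auto simp: H'_def clique_def)
      ultimately show ?thesis by metis
    next
      case False
      then obtain H' D where D: "k_tree k H'" "w \<notin> pverts H'" "clique H' D" "card D = k"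
        "H = join_vertex H' w D" using join.IH[OF False w wC(2)] by metis
      \<comment> \<open>As \<open>w\<close> is not in \<open>C\<close>, the set \<open>C\<close> is
        a clique of \<open>H'\<close> already and the two joins commute.\<close>
      have "k_tree k (join_vertex H' v C)"
        using D join.hyps wC by (intro k_tree.join) (auto simp: clique_def)
      moreover have "join_vertex H v C = join_vertex (join_vertex H' v C) w D"
        by (auto simp: D(5) join_vertex_def)
      moreover have "w \<notin> pverts (join_vertex H' v C)" "clique (join_vertex H' v C) D"
        using D wv by (auto simp: clique_def)
      ultimately show ?thesis using D(4) by metis
    qed
  qed
qed simp

section \<open>Clique sequences of k-paths\<close>

text \<open>
  \<open>k_path_seq k m G w K\<close>: \<open>G\<close> is glued from \<open>m\<close> consecutive \<open>(k + 1)\<close>-cliques, \<open>K\<close> is the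
  last of them and \<open>w\<close> its newest vertex. The next clique has to keep \<open>w\<close>; this is what
  distinguishes \<open>k\<close>-paths from general \<open>k\<close>-trees.
\<close>
inductive k_path_seq :: "nat \<Rightarrow> nat \<Rightarrow> 'v pair_pre_digraph \<Rightarrow> 'v \<Rightarrow> 'v set \<Rightarrow> bool" for k where
  start: "K\<^bsub>k + 1\<^esub> (with_proj G) \<Longrightarrow> w \<in> pverts G \<Longrightarrow> k_path_seq k 1 G w (pverts G)"
| extend: "k_path_seq k m G w K \<Longrightarrow> u \<in> K \<Longrightarrow> u \<noteq> w \<Longrightarrow> v \<notin> pverts G
    \<Longrightarrow> k_path_seq k (Suc m) (join_vertex G v (K - {u})) v (insert v (K - {u}))"

text \<open>The equation for \<open>nb G w\<close> is the key invariant: it confines every clique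
  through the newest vertex to \<open>K\<close>.\<close>

lemma k_path_seqD:
  assumes "k_path_seq k m G w K"
  shows "pair_graph G" "clique G K" "card K = k + 1" "w \<in> K" "nb G w = K - {w}"
    "card (pverts G) = k + m" "m \<ge> 1"
proof -
  have "pair_graph G \<and> clique G K \<and> card K = k + 1 \<and> w \<in> K \<and> nb G w = K - {w}
    \<and> card (pverts G) = k + m \<and> m \<ge> 1"
    using assms
  proof (induction rule: k_path_seq.induct)
    case (start G w)
    then show ?case using nb_complete[OF start] pair_graphI_complete[OF start(1)]
      by (auto simp: complete_digraph_pair_def clique_def)
  next
    case (extend m G w K u v)
    then interpret pair_graph G by blast
    have K: "K \<subseteq> pverts G" using extend by (auto simp: clique_def)
    then have "finite K" using finite_subset pair_finite_verts by blast
    have "v \<notin> K" using K extend.hyps(4) by blast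
    have "K - {u} \<subseteq> pverts G" using K by blast
    then have "pair_graph (join_vertex G v (K - {u}))"
      using extend.hyps(4) pair_graph_axioms by (intro pair_graph_join_vertex)
    moreover have "clique (join_vertex G v (K - {u})) (insert v (K - {u}))"
      using extend by (auto simp: clique_def)
    moreover have "nb (join_vertex G v (K - {u})) v = insert v (K - {u}) - {v}"
      using nb_join_vertex[OF extend.hyps(4) \<open>K - {u} \<subseteq> pverts G\<close>] \<open>v \<notin> K\<close> by auto
    ultimately show ?case
      using extend \<open>finite K\<close> \<open>v \<notin> K\<close> pair_finite_verts by auto
  qed
  then show "pair_graph G" "clique G K" "card K = k + 1" "w \<in> K" "nb G w = K - {w}"
    "card (pverts G) = k + m" "m \<ge> 1" by auto
qed

text \<open>All neighbours of \<open>w1\<close> lie in \<open>K\<close>, hence so does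
  \<open>C\<close>; having \<open>k\<close> elements, it omits exactly one vertex \<open>u\<close>
  of \<open>K\<close>, and \<open>u\<close> is not \<open>w1\<close>.\<close>

lemma k_path_seq_join_vertex:
  assumes "k_path_seq k m H w1 K" "w1 \<in> C" "clique H C" "card C = k" "w \<notin> pverts H"
  shows "\<exists>K'. k_path_seq k (Suc m) (join_vertex H w C) w K'"
proof -
  note D = k_path_seqD[OF assms(1)]
  have "C - {w1} \<subseteq> nb H w1" using assms by (auto simp: clique_def nb_def)
  then have "C \<subseteq> K" using D by auto
  moreover have fK: "finite K" using D(3) by (metis add_is_0 card.infinite one_neq_zero)
  ultimately have "card (K - C) = 1"
    using assms(4) D(3) finite_subset[of C K] by (subst card_Diff_subset) auto
  then obtain u where "K - C = {u}" by (rule card_1_singletonE)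
  then have "C = K - {u}" "u \<in> K" "u \<noteq> w1" using \<open>C \<subseteq> K\<close> assms(2) by auto
  then show ?thesis using k_path_seq.extend[OF assms(1), of u w] assms(5) by blast
qed

text \<open>Induction by peeling off \<open>w\<close>. The vertex \<open>w\<close> is arbitrary
  because the sequence for \<open>H\<close> has to end in the particular vertex \<open>w1\<close> to
  which \<open>w\<close> is attached.\<close>

lemma k_path_imp_seq:
  assumes "k_path k G" "k \<ge> 1" "w \<in> pverts G" "card (nb G w) = k"
  shows "\<exists>m K. k_path_seq k m G w K"
  using assms
proof (induction "card (pverts G)" arbitrary: G w rule: less_induct)
  case less
  let ?S = "\<lambda>G. {v \<in> pverts G. card (nb G v) = k}"
  have tG: "k_tree k G" using less by (simp add: k_path_def)
  show ?case
  proof (cases "K\<^bsub>k + 1\<^esub> (with_proj G)")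
    case True
    then show ?thesis using k_path_seq.start[of k G w] less by blast
  next
    case nc: False
    then have card2: "card (?S G) = 2"
      using less by (simp add: k_path_def out_degree_eq_card_nb)
    obtain H C where H: "k_tree k H" "w \<notin> pverts H" "clique H C" "card C = k"
      "G = join_vertex H w C" using k_tree_peel[OF tG nc] less by blast
    interpret pair_graph H using H by (simp add: k_tree_pair_graph)
    have C: "C \<subseteq> pverts H" using H by (simp add: clique_def)
    have small: "card (pverts H) < card (pverts G)" using H pair_finite_verts by simp
    have "\<exists>w1 \<in> C. k_path k H \<and> card (nb H w1) = k"
    proof (cases "K\<^bsub>k + 1\<^esub> (with_proj H)")
      case True
      obtain w1 where "w1 \<in> C" using H(4) less.prems(2) by fastforce
      then show ?thesis using True H card_nb_complete[OF True] C by (auto simp: k_path_def)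
    next
      case False
      \<comment> \<open>\<open>G\<close> has two degree-\<open>k\<close> vertices, one being
        \<open>w\<close>, so exactly one such vertex of \<open>H\<close> avoids \<open>C\<close>.
        \<open>H\<close> has at least two, and the clique \<open>C\<close> holds at most one of
        them; so \<open>H\<close> has exactly two and is a \<open>k\<close>-path.\<close>
      have SG: "?S G = insert w (?S H - C)"
        using H(2,4) C k_tree_degree_ge[OF H(1)] unfolding H(5)
        by (auto simp: card_nb_join_vertex split: if_splits) (metis Suc_n_not_le_n)+
      have fin: "finite (?S H)" using pair_finite_verts by simp
      have "w \<notin> ?S H - C" "finite (?S H - C)" using H fin by auto
      then have one: "card (?S H - C) = 1" 
        using card2 card_insert_disjoint[of "?S H - C" w] unfolding SG by linarith
      obtain x y where xy: "x \<in> ?S H" "y \<in> ?S H" "x \<noteq> y"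
        using k_tree_two_degree_k[OF H(1) less.prems(2)] by blast
      have "card {x, y} \<le> card (?S H - C)" if "?S H \<inter> C = {}"
        using that xy fin by (intro card_mono) auto
      then have "?S H \<inter> C \<noteq> {}" using one xy(3) by auto
      then obtain w1 where w1: "w1 \<in> ?S H \<inter> C" by (auto simp only: ex_in_conv[symmetric])
      have "z = w1" if z: "z \<in> ?S H \<inter> C" for z
      proof (rule ccontr)
        assume "z \<noteq> w1"
        then have "(w1, z) \<in> parcs H" using H(3) z w1 by (auto simp: clique_def)
        then show False using k_tree_degree_k_nonadjacent[OF H(1) False, of w1 z] w1 z by simp
      qed
      then have "?S H \<inter> C = {w1}" using w1 by blast
      then have "card (?S H) = 2"
        using one fin card_Diff_subset_Int[of "?S H" C] xy
          card_mono[OF fin, of "{x, y}"] by simp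
      then show ?thesis using w1 H by (auto simp: k_path_def out_degree_eq_card_nb)
    qed
    then obtain w1 where w1: "w1 \<in> C" "k_path k H" "card (nb H w1) = k" by blast
    then obtain m K where "k_path_seq k m H w1 K"
      using less.hyps[OF small, of w1] less.prems C by blast
    then show ?thesis using k_path_seq_join_vertex[OF _ w1(1) H(3,4,2)] H(5) by blast
  qed
qed

lemma k_path_obtain_seq:
  assumes "k_path k G" "k \<ge> 1"
  obtains m w K where "k_path_seq k m G w K"
proof -
  have "k_tree k G" using assms by (simp add: k_path_def)
  then obtain w where "w \<in> pverts G" "card (nb G w) = k"
    using k_tree_two_degree_k assms(2) by metis
  then show ?thesis using k_path_imp_seq[OF assms] that by blast
qed

section \<open>Representations by vectors in a symplectic space\<close>

text \<open>The standard symplectic form in dimension \<open>2 * h\<close>; \<open>p i x\<close> and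
  \<open>q i x\<close> are the coordinates of the vector attached to the vertex
  \<open>x\<close>.\<close>

definition symp :: "(nat \<Rightarrow> 'v \<Rightarrow> 'a::field) \<Rightarrow> (nat \<Rightarrow> 'v \<Rightarrow> 'a) \<Rightarrow> nat \<Rightarrow> 'v \<Rightarrow> 'v \<Rightarrow> 'a" where
  "symp p q h x y = (\<Sum>i<h. p i x * q i y - q i x * p i y)"

text \<open>The Gram matrix of such vectors lies in \<open>S_minus\<close> and has rank at most
  \<open>2 * h\<close>.\<close>

definition represents ::
  "(nat \<Rightarrow> 'v \<Rightarrow> 'a::field) \<Rightarrow> (nat \<Rightarrow> 'v \<Rightarrow> 'a) \<Rightarrow> nat \<Rightarrow> 'v pair_pre_digraph \<Rightarrow> bool" where
  "represents p q h G \<longleftrightarrow>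
     (\<forall>x\<in>pverts G. \<forall>y\<in>pverts G. x \<noteq> y \<longrightarrow> (symp p q h x y \<noteq> 0 \<longleftrightarrow> (x, y) \<in> parcs G))"

lemma infinite_field_inj_on:
  assumes "infinite (UNIV :: 'a::field set)" "finite V"
  obtains c :: "'v \<Rightarrow> 'a::field" where "inj_on c V"
proof -
  obtain B :: "'a set" where "finite B" "card B = card V"
    using infinite_arbitrarily_large[OF assms(1)] by blast
  then show ?thesis
    using that inj_on_iff_card_le[OF assms(2), of B] by auto
qed

lemma represents_complete:
  assumes inf: "infinite (UNIV :: 'a::field set)" and K: "K\<^bsub>n\<^esub> (with_proj G)"
  shows "\<exists>p q :: nat \<Rightarrow> 'v \<Rightarrow> 'a::field. represents p q 1 G"
proof -
  have "finite (pverts G)" using K by (simp add: complete_digraph_pair_def)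
  with inf obtain c :: "'v \<Rightarrow> 'a" where "inj_on c (pverts G)"
    by (rule infinite_field_inj_on)
  \<comment> \<open>The vectors \<open>(1, c x)\<close> and \<open>(1, c y)\<close> pair to
    \<open>c y - c x\<close>.\<close>
  then have "represents (\<lambda>_ _. 1) (\<lambda>_. c) 1 G"
    using K by (auto simp: represents_def symp_def complete_digraph_pair_def inj_on_def)
  then show ?thesis by blast
qed

text \<open>The new vertex copies the vector of \<open>u\<close>: equal vectors are orthogonal and
  pair alike with all others.\<close>

lemma represents_complete_join_vertex:
  assumes inf: "infinite (UNIV :: 'a::field set)" and K: "K\<^bsub>n\<^esub> (with_proj G)"
    and u: "u \<in> pverts G" and v: "v \<notin> pverts G"
  shows "\<exists>p q :: nat \<Rightarrow> 'v \<Rightarrow> 'a::field. represents p q 1 (join_vertex G v (pverts G - {u}))"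
proof -
  have "finite (pverts G)" using K by (simp add: complete_digraph_pair_def)
  with inf obtain c :: "'v \<Rightarrow> 'a" where c: "inj_on c (pverts G)"
    by (rule infinite_field_inj_on)
  have "represents (\<lambda>_ _. 1) (\<lambda>_. c(v := c u)) 1 (join_vertex G v (pverts G - {u}))"
    using K u v c by (auto simp: represents_def symp_def complete_digraph_pair_def dest: inj_onD)
  then show ?thesis by blast
qed

text \<open>
  The two new vertices form a hyperbolic pair, and the bag \<open>K\<close> gets components along it. This changes
  the form only between \<open>u'\<close> and other vertices of \<open>K\<close>, by \<open>\<plusminus>t\<close>; as those pairs are adjacent it suffices that
  \<open>t\<close> avoids finitely many values.
\<close>
lemma represents_join_two_vertices:
  fixes p q :: "nat \<Rightarrow> 'v \<Rightarrow> 'a::field"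
  assumes inf: "infinite (UNIV :: 'a set)" and rep: "represents p q h G"
    and G: "pair_graph G" and K: "clique G K"
    and u: "u \<in> K" "u' \<in> K" "u \<noteq> u'" and v: "v \<notin> pverts G" "v' \<notin> pverts G" "v \<noteq> v'"
  shows "\<exists>p' q' :: nat \<Rightarrow> 'v \<Rightarrow> 'a. represents p' q' (Suc h)
    (join_vertex (join_vertex G v (K - {u})) v' (insert v (K - {u}) - {u'}))"
proof -
  interpret pair_graph G by fact
  let ?G = "join_vertex (join_vertex G v (K - {u})) v' (insert v (K - {u}) - {u'})"
  let ?V = "pverts G"
  \<comment> \<open>\<open>t\<close> has to avoid all values of the form and their negatives, so
    that adding \<open>t\<close> or \<open>- t\<close> never cancels; \<open>0\<close> is included
    to make \<open>t\<close> nonzero.\<close>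
  define F where "F = insert 0 ((\<lambda>(x, y). symp p q h x y) ` (?V \<times> ?V))"
  have "finite F" using pair_finite_verts by (simp add: F_def)
  then have "finite (F \<union> uminus ` F)" by simp
  then obtain t where "t \<notin> F \<union> uminus ` F" using inf ex_new_if_finite by blast
  then have t0: "t \<noteq> 0"
    and t: "\<And>x y. x \<in> ?V \<Longrightarrow> y \<in> ?V \<Longrightarrow> symp p q h x y \<noteq> t \<and> symp p q h x y \<noteq> - t"
    by (force simp: F_def image_iff)+
  \<comment> \<open>In the new plane \<open>v\<close> is \<open>(1, 0)\<close>, \<open>v'\<close>
    and \<open>u'\<close> are \<open>(0, 1)\<close>, the other vertices of \<open>K - {u}\<close>
    are \<open>(t, 1)\<close> and all else is zero. So within \<open>K\<close>, \<open>v\<close> is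
    orthogonal only to \<open>u\<close>, and \<open>v'\<close> only to \<open>u\<close> and
    \<open>u'\<close>.\<close>
  define a where "a x = (if x = v then 1 else if x \<in> K - {u, u'} then t else 0)" for x
  define b where "b x = (if x = v' then 1 else if x \<in> K - {u} then 1 else 0 :: 'a)" for x
  \<comment> \<open>\<open>p\<close> and \<open>q\<close> are unconstrained at \<open>v\<close> and
    \<open>v'\<close>, so the old coordinates are set to zero off \<open>?V\<close>.\<close>
  define p' where "p' i x = (if i < h then if x \<in> ?V then p i x else 0 else a x)" for i x
  define q' where "q' i x = (if i < h then if x \<in> ?V then q i x else 0 else b x)" for i x
  have KV: "K \<subseteq> ?V" using K by (simp add: clique_def)
  then have vK: "v \<notin> K" "v' \<notin> K" using v by auto
  have symp': "symp p' q' (Suc h) x y =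
      (if x \<in> ?V \<and> y \<in> ?V then symp p q h x y else 0) + (a x * b y - b x * a y)" for x y
    by (auto simp: symp_def p'_def q'_def)
  have old: "(symp p' q' (Suc h) x y \<noteq> 0) = ((x, y) \<in> parcs ?G)"
    if xy: "x \<in> ?V" "y \<in> ?V" "x \<noteq> y" for x y
  proof -
    have E: "(symp p q h x y \<noteq> 0) = ((x, y) \<in> parcs G)"
      using rep xy by (simp add: represents_def)
    have "x \<noteq> v" "x \<noteq> v'" "y \<noteq> v" "y \<noteq> v'" using xy v by auto
    then have E': "((x, y) \<in> parcs ?G) = ((x, y) \<in> parcs G)"
      and d: "a x * b y - b x * a y \<in> {0, t, - t}"
        "a x * b y - b x * a y \<noteq> 0 \<Longrightarrow> x \<in> K \<and> y \<in> K"
      by (auto simp: a_def b_def split: if_splits)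
    show ?thesis
    proof (cases "a x * b y - b x * a y = 0")
      case True
      then show ?thesis using E E' xy by (simp add: symp')
    next
      case False
      then have "x \<in> K" "y \<in> K" using d(2) by auto
      then have "(x, y) \<in> parcs G" using K xy by (auto simp: clique_def)
      moreover have "symp p q h x y + (a x * b y - b x * a y) \<noteq> 0"
      proof -
        have "symp p q h x y + e \<noteq> 0" if "e = t \<or> e = - t" for e
          using t[OF xy(1,2)] that by (auto simp: add_eq_0_iff2)
        then show ?thesis using d(1) False by blast
      qed
      ultimately show ?thesis using E' xy by (simp add: symp')
    qed
  qed
  have new: "(symp p' q' (Suc h) v y \<noteq> 0) = ((v, y) \<in> parcs ?G)"
      "(symp p' q' (Suc h) y v \<noteq> 0) = ((y, v) \<in> parcs ?G)"
      "(symp p' q' (Suc h) v' y \<noteq> 0) = ((v', y) \<in> parcs ?G)"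
      "(symp p' q' (Suc h) y v' \<noteq> 0) = ((y, v') \<in> parcs ?G)" if y: "y \<in> ?V" for y
  proof -
    have "y \<noteq> v" "y \<noteq> v'" "(v, y) \<notin> parcs G" "(v', y) \<notin> parcs G" "(y, v) \<notin> parcs G" "(y, v') \<notin> parcs G"
      using y v wellformed' by auto
    then show "(symp p' q' (Suc h) v y \<noteq> 0) = ((v, y) \<in> parcs ?G)"
      "(symp p' q' (Suc h) y v \<noteq> 0) = ((y, v) \<in> parcs ?G)"
      "(symp p' q' (Suc h) v' y \<noteq> 0) = ((v', y) \<in> parcs ?G)"
      "(symp p' q' (Suc h) y v' \<noteq> 0) = ((y, v') \<in> parcs ?G)"
      using v u vK t0 by (auto simp: symp' a_def b_def)
  qed
  have "(symp p' q' (Suc h) v v' \<noteq> 0) = ((v, v') \<in> parcs ?G)"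
      "(symp p' q' (Suc h) v' v \<noteq> 0) = ((v', v) \<in> parcs ?G)"
    using v u vK KV by (auto simp: symp' a_def b_def)
  note vv' = this
  define R where "R x y \<longleftrightarrow> (symp p' q' (Suc h) x y \<noteq> 0) = ((x, y) \<in> parcs ?G)" for x y
  have "R v v'" "R v' v" unfolding R_def by (fact vv')+
  moreover have "R x y" if "x \<in> ?V" "y \<in> ?V" "x \<noteq> y" for x y
    unfolding R_def using that by (rule old)
  moreover have "R v y" "R y v" "R v' y" "R y v'" if "y \<in> ?V" for y
    unfolding R_def by (fact new[OF that])+
  ultimately have "R x y" if "x \<in> pverts ?G" "y \<in> pverts ?G" "x \<noteq> y" for x y
    using that unfolding join_vertex_simps by (elim insertE) simp_all
  then have "represents p' q' (Suc h) ?G"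
    unfolding represents_def R_def by (intro ballI impI)
  then show ?thesis by blast
qed

lemma k_path_seq_represents:
  assumes inf: "infinite (UNIV :: 'a::field set)" and "k_path_seq k m G w K"
  shows "\<exists>p q :: nat \<Rightarrow> 'v \<Rightarrow> 'a::field. represents p q ((m + 1) div 2) G"
proof -
  define rep where
    "rep h H \<longleftrightarrow> (\<exists>p q :: nat \<Rightarrow> 'v \<Rightarrow> 'a. represents p q h H)" for h and H :: "'v pair_pre_digraph"
  \<comment> \<open>The form grows by one hyperbolic plane per two new vertices, so the induction carries along all
    extensions of \<open>G\<close> by one more vertex.\<close>
  have "rep ((m + 1) div 2) G \<and>
    (\<forall>u v. u \<in> K \<longrightarrow> u \<noteq> w \<longrightarrow> v \<notin> pverts G \<longrightarrow>
      rep ((m + 2) div 2) (join_vertex G v (K - {u})))"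
    using assms(2)
  proof (induction rule: k_path_seq.induct)
    case (start G w)
    have "rep 1 G" unfolding rep_def by (rule represents_complete[OF inf start(1)])
    moreover have "rep 1 (join_vertex G v (pverts G - {u}))"
      if "u \<in> pverts G" "v \<notin> pverts G" for u v
      unfolding rep_def by (rule represents_complete_join_vertex[OF inf start(1) that])
    ultimately show ?case by simp
  next
    case (extend m G w K u v)
    note D = k_path_seqD[OF extend.hyps(1)]
    \<comment> \<open>The two halves of the claim shift: the extension half for \<open>m\<close> is
      the first half for \<open>Suc m\<close>, and joining two vertices to \<open>G\<close> gives
      the new extension half, as \<open>(m + 3) div 2 = Suc ((m + 1) div 2)\<close>.\<close>
    have "rep (Suc h) (join_vertex (join_vertex G v (K - {u})) v' (insert v (K - {u}) - {u'}))"
      if repG: "rep h G" and u': "u' \<in> insert v (K - {u})" "u' \<noteq> v" and v': "v' \<notin> insert v (pverts G)" for h u' v'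
    proof -
      obtain p q :: "nat \<Rightarrow> 'v \<Rightarrow> 'a" where pq: "represents p q h G"
        using repG unfolding rep_def by blast
      show ?thesis unfolding rep_def
        using u' v' extend.hyps(2,4)
        by (intro represents_join_two_vertices[OF inf pq D(1,2)]) auto
    qed
    moreover have "rep ((m + 2) div 2) (join_vertex G v (K - {u}))"
      using extend.IH extend.hyps by simp
    ultimately show ?case using extend.IH by simp
  qed
  then show ?thesis unfolding rep_def by (rule conjunct1)
qed

section \<open>The triangular pattern in a clique sequence\<close>

lemma k_path_seq_triangular:
  assumes "k_path_seq k m G w K" "k \<ge> 1"
  shows "\<exists>f g. (\<forall>t<m. f t \<in> pverts G \<and> g t \<in> pverts G \<and> (f t, g t) \<in> parcs G) \<and>
    (\<forall>t s. t < s \<longrightarrow> s < m \<longrightarrow> (f t, g s) \<notin> parcs G)"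
proof -
  \<comment> \<open>The last clique has dropped nothing yet, so \<open>f\<close> is constrained only
    below \<open>m - 1\<close>. Carrying \<open>f t \<notin> K\<close> along keeps dropped vertices
    non-adjacent to all later ones.\<close>
  have "\<exists>f g. (\<forall>t<m. g t \<in> pverts G) \<and> g (m - 1) = w \<and>
    (\<forall>t<m - 1. f t \<in> pverts G \<and> f t \<notin> K \<and> (f t, g t) \<in> parcs G) \<and>
    (\<forall>t s. t < s \<longrightarrow> s < m \<longrightarrow> (f t, g s) \<notin> parcs G)"
    using assms(1)
  proof (induction rule: k_path_seq.induct)
    case (start G w)
    then show ?case by (intro exI[of _ "\<lambda>_. w"]) auto
  next
    case (extend m G w K u v)
    note D = k_path_seqD[OF extend.hyps(1)]
    interpret pair_graph G by fact
    from extend.IH obtain f g where g: "\<And>t. t < m \<Longrightarrow> g t \<in> pverts G" "g (m - 1) = w"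
      and f: "\<And>t. t < m - 1 \<Longrightarrow> f t \<in> pverts G \<and> f t \<notin> K \<and> (f t, g t) \<in> parcs G"
      and fg: "\<And>t s. t < s \<Longrightarrow> s < m \<Longrightarrow> (f t, g s) \<notin> parcs G" by blast
    let ?f = "f(m - 1 := u)" and ?g = "g(m := v)" and ?G = "join_vertex G v (K - {u})"
    have KV: "K \<subseteq> pverts G" using D(2) by (simp add: clique_def)
    have uw: "(u, w) \<in> parcs G" using D extend.hyps by (auto simp: clique_def)
    have "\<forall>t<Suc m. ?g t \<in> pverts ?G" using g by simp
    moreover have "?g (Suc m - 1) = v" by simp
    moreover have "?f t \<in> pverts ?G \<and> ?f t \<notin> insert v (K - {u}) \<and> (?f t, ?g t) \<in> parcs ?G"
      if "t < Suc m - 1" for t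
    proof (cases "t = m - 1")
      case True
      then show ?thesis using uw g(2) extend.hyps KV that by auto
    next
      case False
      then have "t < m - 1" using that by simp
      then show ?thesis using f[of t] extend.hyps(4) that by auto
    qed
    moreover have "(?f t, ?g s) \<notin> parcs ?G" if ts: "t < s" "s < Suc m" for t s
    proof (cases "s = m")
      case True
      \<comment> \<open>The neighbours of \<open>v\<close> are exactly \<open>K - {u}\<close>, which
        contains no dropped vertex.\<close>
      have "?f t \<in> pverts G" "?f t \<notin> K - {u}"
        using ts True f[of t] extend.hyps KV by (cases "t = m - 1"; auto)+
      then have "?f t \<noteq> v" "(?f t, v) \<notin> parcs G"
        using extend.hyps(4) wellformed' by auto
      then show ?thesis using True \<open>?f t \<notin> K - {u}\<close> by auto
    next
      case False
      then have s: "s < m" "t < m - 1" using ts by auto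
      then have "f t \<noteq> v" "g s \<noteq> v" using f[of t] g(1)[of s] extend.hyps(4) by auto
      then show ?thesis using s fg[OF ts(1) s(1)] by auto
    qed
    ultimately show ?case by blast
  qed
  then obtain f g where g: "\<And>t. t < m \<Longrightarrow> g t \<in> pverts G" "g (m - 1) = w"
    and f: "\<And>t. t < m - 1 \<Longrightarrow> f t \<in> pverts G \<and> f t \<notin> K \<and> (f t, g t) \<in> parcs G"
    and fg: "\<And>t s. t < s \<Longrightarrow> s < m \<Longrightarrow> (f t, g s) \<notin> parcs G" by blast
  note D = k_path_seqD[OF assms(1)]
  \<comment> \<open>For the final clique any vertex other than \<open>w\<close> completes
    \<open>f\<close>; one exists since \<open>K\<close> has at least two elements.\<close>
  have "K \<noteq> {w}" using D(3) assms(2) by auto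
  then obtain u where u: "u \<in> K" "u \<noteq> w" using D(4) by blast
  then have uw: "(u, w) \<in> parcs G" "u \<in> pverts G" using D by (auto simp: clique_def)
  have "(f(m - 1 := u)) t \<in> pverts G \<and> g t \<in> pverts G \<and> ((f(m - 1 := u)) t, g t) \<in> parcs G"
    if "t < m" for t
    using that f[of t] g(1)[of t] g(2) uw by (cases "t = m - 1") auto
  moreover have "((f(m - 1 := u)) t, g s) \<notin> parcs G" if "t < s" "s < m" for t s
    using that fg[of t s] by auto
  ultimately show ?thesis by blast
qed

section \<open>Bounds on rank and its parity\<close>

context vec_space
begin

text \<open>A maximal independent set of columns has as many elements as the rank. It is presented
  by indices \<open>idx\<close> so that the principal submatrix on the same indices can be
  formed.\<close>

lemma rank_column_basis:
  assumes A: "A \<in> carrier_mat n nc"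
  obtains idx where "\<And>j. j < rank A \<Longrightarrow> idx j < nc"
    and "\<And>z. z \<in> carrier_vec (rank A) \<Longrightarrow>
      mat n (rank A) (\<lambda>(i, j). A $$ (i, idx j)) *\<^sub>v z = 0\<^sub>v n \<Longrightarrow> z = 0\<^sub>v (rank A)"
    and "\<And>l. l < nc \<Longrightarrow> \<exists>c \<in> carrier_vec (rank A).
      col A l = mat n (rank A) (\<lambda>(i, j). A $$ (i, idx j)) *\<^sub>v c"
proof -
  let ?P = "\<lambda>T. T \<subseteq> set (cols A) \<and> lin_indpt T"
  have colsA: "set (cols A) \<subseteq> carrier_vec n" using A cols_dim by blast
  have "?P {}" using finite_lin_indpt2[of "{}"] by simp
  then obtain S where S: "finite S" "maximal S ?P"
    using maximal_exists_superset[of "set (cols A)" ?P "{}"] by blast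
  then have SA: "S \<subseteq> set (cols A)" and indS: "lin_indpt S" by (auto simp: maximal_def)
  have rS: "rank A = card S" using rank_card_indpt[OF A S(2)] .
  obtain bs where bs: "set bs = S" "distinct bs" using S(1) finite_distinct_list by blast
  then have len: "length bs = rank A" using rS distinct_card by fastforce
  have "\<forall>b\<in>set bs. \<exists>l<nc. b = col A l"
    using bs SA A unfolding cols_def by (fastforce simp: image_iff)
  then have "\<forall>j<length bs. \<exists>l. l < nc \<and> bs ! j = col A l" by (meson nth_mem)
  then obtain idx where idx: "\<And>j. j < rank A \<Longrightarrow> idx j < nc \<and> bs ! j = col A (idx j)"
    unfolding len by metis
  let ?Q = "mat n (rank A) (\<lambda>(i, j). A $$ (i, idx j))"
  have colQ: "col ?Q j = bs ! j" if "j < rank A" for j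
    using that idx[OF that] A by (intro eq_vecI) auto
  have colsQ: "cols ?Q = bs"
    using len colQ by (intro nth_equalityI) auto
  have Q: "?Q \<in> carrier_mat n (rank A)" by simp
  have "z = 0\<^sub>v (rank A)" if "z \<in> carrier_vec (rank A)" "?Q *\<^sub>v z = 0\<^sub>v n" for z
    using lin_depI[OF Q that(1) _ that(2)] colsQ bs indS by auto
  moreover have "\<exists>c \<in> carrier_vec (rank A). col A l = ?Q *\<^sub>v c" if l: "l < nc" for l
  proof -
    have inA: "col A l \<in> set (cols A)" using l A by (auto simp: cols_def)
    have "col A l \<in> span S"
    proof (rule ccontr)
      assume nin: "col A l \<notin> span S"
      have SV: "S \<subseteq> carrier_vec n" using SA colsA by blast
      then have "col A l \<notin> S" using nin in_own_span by blast
      have "lin_indpt (insert (col A l) S)"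
        using lin_dep_iff_in_span[of S "col A l"] SV indS inA colsA nin \<open>col A l \<notin> S\<close> by auto
      then have "?P (insert (col A l) S)" using inA SA by simp
      then show False using S(2) \<open>col A l \<notin> S\<close> unfolding maximal_def by blast
    qed
    then obtain a where "lincomb a S = col A l"
      using finite_in_span[OF S(1), of "col A l"] SA colsA by auto
    then have "col A l = ?Q *\<^sub>v vec (rank A) (\<lambda>i. a (col ?Q i))"
      using mat_mult_eq_lincomb[OF Q, of a] colsQ bs by simp
    then show ?thesis by (intro bexI) auto
  qed
  ultimately show thesis using that[of idx] idx by blast
qed

text \<open>
  The principal submatrix on a column basis is invertible, since by skew-symmetry its kernel
  lies in the kernel of the basis columns; an invertible skew-symmetric matrix has even size.
\<close>
lemma even_rank_skew:
  assumes two: "(2 :: 'a) \<noteq> 0" and A: "A \<in> carrier_mat n n" and skew: "transpose_mat A = - A"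
  shows "even (rank A)"
proof -
  let ?r = "rank A"
  obtain idx where idx: "\<And>j. j < ?r \<Longrightarrow> idx j < n"
    and ker: "\<And>z. z \<in> carrier_vec ?r \<Longrightarrow>
      mat n ?r (\<lambda>(i, j). A $$ (i, idx j)) *\<^sub>v z = 0\<^sub>v n \<Longrightarrow> z = 0\<^sub>v ?r"
    and gen: "\<And>l. l < n \<Longrightarrow> \<exists>c \<in> carrier_vec ?r.
      col A l = mat n ?r (\<lambda>(i, j). A $$ (i, idx j)) *\<^sub>v c"
    using rank_column_basis[OF A] by blast
  have sk: "A $$ (i, j) = - A $$ (j, i)" if "i < n" "j < n" for i j
  proof -
    have "transpose_mat A $$ (j, i) = (- A) $$ (j, i)" using skew by simp
    then show ?thesis using that A by simp
  qed
  let ?Q = "mat n ?r (\<lambda>(i, j). A $$ (i, idx j))"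
  define M where "M = mat ?r ?r (\<lambda>(i, j). A $$ (idx i, idx j))"
  have M: "M \<in> carrier_mat ?r ?r" by (simp add: M_def)
  have "det M \<noteq> 0"
  proof
    assume "det M = 0"
    then obtain z where z: "z \<in> carrier_vec ?r" "z \<noteq> 0\<^sub>v ?r" "M *\<^sub>v z = 0\<^sub>v ?r"
      using det_0_iff_vec_prod_zero_field[OF M] by blast
    have Mz: "(\<Sum>j<?r. A $$ (idx i, idx j) * z $ j) = 0" if "i < ?r" for i
    proof -
      have "(M *\<^sub>v z) $ i = 0" using z(3) that by simp
      then show ?thesis using that z(1) M
        by (simp add: M_def scalar_prod_def lessThan_atLeast0)
    qed
    \<comment> \<open>By skew-symmetry row \<open>l\<close> of \<open>?Q\<close> is the combination
      of the rows of \<open>M\<close> with the coefficients \<open>c\<close> of column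
      \<open>l\<close>, and every row of \<open>M\<close> annihilates \<open>z\<close>.\<close>
    have "(?Q *\<^sub>v z) $ l = 0" if l: "l < n" for l
    proof -
      obtain c where c: "c \<in> carrier_vec ?r" "col A l = ?Q *\<^sub>v c" using gen[OF l] by blast
      have Al: "A $$ (i, l) = (\<Sum>j<?r. A $$ (i, idx j) * c $ j)" if "i < n" for i
      proof -
        have "A $$ (i, l) = (?Q *\<^sub>v c) $ i" using c(2) that l A by (metis carrier_matD index_col)
        then show ?thesis using that c(1) by (simp add: scalar_prod_def lessThan_atLeast0)
      qed
      have "(?Q *\<^sub>v z) $ l = (\<Sum>j<?r. A $$ (l, idx j) * z $ j)"
        using l z(1) by (simp add: scalar_prod_def lessThan_atLeast0)
      also have "\<dots> = (\<Sum>j<?r. - (\<Sum>i<?r. A $$ (idx j, idx i) * c $ i) * z $ j)"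
      proof (intro sum.cong refl)
        fix j assume "j \<in> {..<?r}"
        then show "A $$ (l, idx j) * z $ j = - (\<Sum>i<?r. A $$ (idx j, idx i) * c $ i) * z $ j"
          using sk[OF l, of "idx j"] Al[of "idx j"] idx[of j] by (simp only: lessThan_iff)
      qed
      also have "\<dots> = (\<Sum>j<?r. \<Sum>i<?r. c $ i * (A $$ (idx i, idx j) * z $ j))"
      proof (intro sum.cong refl)
        fix j assume "j \<in> {..<?r}"
        then have "A $$ (idx i, idx j) = - A $$ (idx j, idx i)" if "i < ?r" for i
          using that sk[of "idx i" "idx j"] idx by blast
        then show "- (\<Sum>i<?r. A $$ (idx j, idx i) * c $ i) * z $ j
            = (\<Sum>i<?r. c $ i * (A $$ (idx i, idx j) * z $ j))"
          unfolding sum_negf[symmetric] sum_distrib_right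
          by (intro sum.cong) (auto simp: algebra_simps)
      qed
      also have "\<dots> = (\<Sum>i<?r. c $ i * (\<Sum>j<?r. A $$ (idx i, idx j) * z $ j))"
        by (subst sum.swap) (simp add: sum_distrib_left)
      also have "\<dots> = 0" using Mz by simp
      finally show ?thesis .
    qed
    then have "?Q *\<^sub>v z = 0\<^sub>v n" by (intro eq_vecI) auto
    then show False using ker z by blast
  qed
  have MT: "transpose_mat M = (-1) \<cdot>\<^sub>m M"
  proof (rule eq_matI)
    fix i j assume "i < dim_row ((-1) \<cdot>\<^sub>m M)" "j < dim_col ((-1) \<cdot>\<^sub>m M)"
    then show "transpose_mat M $$ (i, j) = ((-1) \<cdot>\<^sub>m M) $$ (i, j)"
      using sk[of "idx j" "idx i"] idx by (simp add: M_def)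
  qed (simp_all add: M_def)
  have "det M = (-1) ^ ?r * det M"
    using det_transpose[OF M] M unfolding MT by simp
  show ?thesis
  proof (rule ccontr)
    assume "odd ?r"
    then have "det M = - det M" using \<open>det M = (-1) ^ ?r * det M\<close> by simp
    then have "2 * det M = 0" by (metis add.right_inverse mult_2)
    then show False using two \<open>det M \<noteq> 0\<close> by simp
  qed
qed

text \<open>The columns chosen by \<open>g\<close> are independent: in a linear relation row
  \<open>f 0\<close> kills the first coefficient, then row \<open>f 1\<close> the second, and so
  on.\<close>

lemma rank_ge_triangular:
  assumes A: "A \<in> carrier_mat n nc"
    and f: "\<And>t. t < m \<Longrightarrow> f t < n" and g: "\<And>t. t < m \<Longrightarrow> g t < nc"
    and diag: "\<And>t. t < m \<Longrightarrow> A $$ (f t, g t) \<noteq> 0"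
    and upper: "\<And>t s. t < s \<Longrightarrow> s < m \<Longrightarrow> A $$ (f t, g s) = 0"
  shows "m \<le> rank A"
proof -
  define B where "B = mat n m (\<lambda>(i, j). A $$ (i, g j))"
  have B: "B \<in> carrier_mat n m" by (simp add: B_def)
  have colB: "col B j = col A (g j)" if "j < m" for j
    using that A g[OF that] by (intro eq_vecI) (auto simp: B_def)
  \<comment> \<open>Independence concerns the set of columns, so it must be known to have
    \<open>m\<close> elements; row \<open>f i\<close> separates column \<open>i\<close> from each
    later one.\<close>
  have "cols B ! i \<noteq> cols B ! j" if "i < j" "j < m" for i j
  proof
    assume "cols B ! i = cols B ! j"
    then have "col B i $ f i = col B j $ f i" using that B by (auto simp: cols_nth)
    then show False using that f[of i] diag[of i] upper[of i j] by (simp add: B_def)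
  qed
  then have dist: "distinct (cols B)"
    using B unfolding distinct_conv_nth by (metis carrier_matD(2) cols_length nat_neq_iff)
  have "lin_indpt (set (cols B))"
  proof
    assume "lin_dep (set (cols B))"
    then obtain z where z: "z \<in> carrier_vec m" "z \<noteq> 0\<^sub>v m" "B *\<^sub>v z = 0\<^sub>v n"
      using lin_depE[OF B _ dist] by blast
    have "z $ t = 0" if "t < m" for t
      using that
    proof (induction t rule: less_induct)
      case (less t)
      have "0 = (B *\<^sub>v z) $ f t" using z f[OF less.prems] by simp
      also have "\<dots> = (\<Sum>j<m. A $$ (f t, g j) * z $ j)"
        using z(1) f[OF less.prems] by (simp add: B_def scalar_prod_def lessThan_atLeast0)
      also have "\<dots> = (\<Sum>j<m. if j = t then A $$ (f t, g t) * z $ t else 0)"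
      proof (intro sum.cong refl)
        fix j assume "j \<in> {..<m}"
        then show "A $$ (f t, g j) * z $ j = (if j = t then A $$ (f t, g t) * z $ t else 0)"
          using less upper[of t j] by (cases j t rule: linorder_cases) auto
      qed
      also have "\<dots> = A $$ (f t, g t) * z $ t" using less.prems by simp
      finally show ?case using diag[OF less.prems] by simp
    qed
    then have "z = 0\<^sub>v m" using z(1) by (intro eq_vecI) auto
    then show False using z by blast
  qed
  moreover have "set (cols B) \<subseteq> set (cols A)"
  proof
    fix b assume "b \<in> set (cols B)"
    then obtain j where "j < m" "b = col B j" using B by (auto simp: cols_def)
    then show "b \<in> set (cols A)" using colB[of j] g[of j] A by (auto simp: cols_def)
  qed
  ultimately have "card (set (cols B)) \<le> rank A"
    using rank_ge_card_indpt[OF A] by blast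
  then show ?thesis using distinct_card[OF dist] B by simp
qed

text \<open>Each product contributes a matrix of rank at most one, and rank is subadditive.\<close>

lemma rank_sum_products_le:
  assumes "A \<in> carrier_mat n nc"
    and "\<And>x y. x < n \<Longrightarrow> y < nc \<Longrightarrow> A $$ (x, y) = (\<Sum>i<h. f i x * g i y)"
  shows "rank A \<le> h"
  using assms
proof (induction h arbitrary: A)
  case 0
  then have "A = 0\<^sub>m n nc" by (intro eq_matI) auto
  then show ?case by (simp add: rank_0I)
next
  case (Suc h)
  define B where "B = mat n nc (\<lambda>(x, y). \<Sum>i<h. f i x * g i y)"
  define C where "C = mat n nc (\<lambda>(x, y). f h x * g h y)"
  have "A = B + C" using Suc.prems by (intro eq_matI) (auto simp: B_def C_def)
  moreover have "rank B \<le> h" by (rule Suc.IH) (auto simp: B_def)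
  moreover have "rank C \<le> 1"
    by (rule rank_le_1_product_entries[of C nc "f h" "g h"]) (auto simp: C_def)
  moreover have "rank (B + C) \<le> rank B + rank C"
    by (rule rank_subadditive[of _ nc]) (auto simp: B_def C_def)
  ultimately show ?case by simp
qed

end

section \<open>The minimum rank of a k-path\<close>

lemma two_neq_zero_of_char:
  assumes "CHAR('a::field) \<noteq> 2"
  shows "(2 :: 'a) \<noteq> 0"
proof
  assume "(2 :: 'a) = 0"
  then have "of_nat 2 = (0 :: 'a)" by simp
  then have "CHAR('a) dvd 2" by (simp only: of_nat_eq_0_iff_char_dvd)
  then have "CHAR('a) = 1 \<or> CHAR('a) = 2" by (meson prime_nat_iff two_is_prime_nat)
  moreover have "CHAR('a) \<noteq> 1" using CHAR_not_1 by simp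
  ultimately show False using assms by blast
qed

text \<open>\<open>S_minus\<close> ties only off-diagonal entries to arcs; the diagonal vanishes by
  skew-symmetry and \<open>2 \<noteq> 0\<close>. Equal indices are covered because
  \<open>k_path_seq_triangular\<close> does not state that \<open>f t\<close> and \<open>g s\<close>
  differ.\<close>

lemma S_minus_entry_eq_0:
  assumes two: "(2 :: 'a::field) \<noteq> 0" and A: "(A :: 'a mat) \<in> S_minus G vs"
    and ij: "i < length vs" "j < length vs" "(vs ! i, vs ! j) \<notin> parcs G"
  shows "A $$ (i, j) = 0"
proof (cases "i = j")
  case True
  have "transpose_mat A $$ (i, i) = (- A) $$ (i, i)" "A \<in> carrier_mat (length vs) (length vs)"
    using A by (simp_all add: S_minus_def)
  then have "A $$ (i, i) = - A $$ (i, i)" using ij by simp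
  then have "2 * A $$ (i, i) = 0" by (metis add.right_inverse mult_2)
  then show ?thesis using two True by simp
next
  case False
  then show ?thesis using A ij by (auto simp: S_minus_def)
qed

theorem theorem3p2:
  fixes G :: "'v pair_pre_digraph" and vs :: "'v list" and k n :: nat
  assumes "infinite (UNIV :: 'a :: field set)"
    and "CHAR('a) \<noteq> 2"
    and "k \<ge> 1"
    and "k_path k G"
    and "card (pverts G) = n"
    and "distinct vs" and "set vs = pverts G"
  shows "(even (n - k) \<longrightarrow> mr_minus TYPE('a) G vs = n - k) \<and>
         (odd (n - k) \<longrightarrow> mr_minus TYPE('a) G vs = n - k + 1)"
proof -
  obtain m w K where seq: "k_path_seq k m G w K"
    using k_path_obtain_seq[OF assms(4,3)] .
  note D = k_path_seqD[OF seq]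
  interpret pair_graph G by (rule D)
  \<comment> \<open>\<open>2 * ?h\<close> is \<open>m\<close> rounded up to an even number, and
    \<open>m\<close> is \<open>n - k\<close>; this unites the two parity cases.\<close>
  let ?N = "length vs" and ?h = "(m + 1) div 2"
  interpret V: vec_space "TYPE('a)" ?N .
  have m: "n - k = m" using D(6) assms(5) by simp
  have two: "(2 :: 'a) \<noteq> 0" using two_neq_zero_of_char assms(2) by blast
  have lower: "2 * ?h \<le> V.rank A" if A: "A \<in> S_minus G vs" for A :: "'a mat"
  proof -
    have Ac: "A \<in> carrier_mat ?N ?N" and skew: "transpose_mat A = - A"
      using A by (simp_all add: S_minus_def)
    obtain f g where fg: "\<And>t. t < m \<Longrightarrow> f t \<in> pverts G \<and> g t \<in> pverts G \<and> (f t, g t) \<in> parcs G"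
      and up: "\<And>t s. t < s \<Longrightarrow> s < m \<Longrightarrow> (f t, g s) \<notin> parcs G"
      using k_path_seq_triangular[OF seq assms(3)] by blast
    have "\<forall>x\<in>pverts G. \<exists>i<?N. vs ! i = x" using assms(7) by (metis in_set_conv_nth)
    then obtain ix where ix: "\<And>x. x \<in> pverts G \<Longrightarrow> ix x < ?N \<and> vs ! ix x = x" by metis
    have "m \<le> V.rank A"
    proof (rule V.rank_ge_triangular[OF Ac])
      fix t assume t: "t < m"
      then have "f t \<noteq> g t" using fg[OF t] arc_irrefl by metis
      then have "ix (f t) \<noteq> ix (g t)" using fg[OF t] ix by metis
      then show "A $$ (ix (f t), ix (g t)) \<noteq> 0"
        using A fg[OF t] ix by (simp add: S_minus_def)
    next
      fix t s assume ts: "t < s" "s < m"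
      then have "f t \<in> pverts G" "g s \<in> pverts G" using fg by simp_all
      then show "A $$ (ix (f t), ix (g s)) = 0"
        using ix up[OF ts] by (intro S_minus_entry_eq_0[OF two A]) simp_all
    qed (use fg ix in blast)+
    moreover have "even (V.rank A)" by (rule V.even_rank_skew[OF two Ac skew])
    ultimately show ?thesis by presburger
  qed
  obtain p q :: "nat \<Rightarrow> 'v \<Rightarrow> 'a" where rep: "represents p q ?h G"
    using k_path_seq_represents[OF assms(1) seq] by blast
  define A where "A = mat ?N ?N (\<lambda>(i, j). symp p q ?h (vs ! i) (vs ! j))"
  have "transpose_mat A = - A"
    by (intro eq_matI) (simp_all add: A_def symp_def sum_negf[symmetric] algebra_simps)
  moreover have "A $$ (i, j) \<noteq> 0 \<longleftrightarrow> (vs ! i, vs ! j) \<in> parcs G"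
    if "i < ?N" "j < ?N" "i \<noteq> j" for i j
  proof -
    have "vs ! i \<noteq> vs ! j" "vs ! i \<in> pverts G" "vs ! j \<in> pverts G"
      using that nth_eq_iff_index_eq[OF assms(6)] assms(7) nth_mem by blast+
    then show ?thesis using rep that by (simp add: A_def represents_def)
  qed
  ultimately have AS: "A \<in> S_minus G vs" by (simp add: S_minus_def A_def)
  have split: "(\<Sum>i<a + b. f i) = (\<Sum>i<a. f i) + (\<Sum>i<b. f (a + i))" for a b and f :: "nat \<Rightarrow> 'a"
    by (induction b) (simp_all add: add.assoc)
  have "V.rank A \<le> ?h + ?h"
  proof (rule V.rank_sum_products_le)
    \<comment> \<open>Every summand of the form is a difference of two products: the first
      \<open>?h\<close> terms take \<open>p\<close> times \<open>q\<close>, the remaining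
      \<open>?h\<close> take \<open>- q\<close> times \<open>p\<close>.\<close>
    show "A $$ (x, y) = (\<Sum>i<?h + ?h. (if i < ?h then p i (vs ! x) else - q (i - ?h) (vs ! x))
        * (if i < ?h then q i (vs ! y) else p (i - ?h) (vs ! y)))" if "x < ?N" "y < ?N" for x y
      using that by (simp add: A_def symp_def split sum_subtractf sum_negf)
  qed (simp add: A_def)
  then have rA: "V.rank A = 2 * ?h" using lower[OF AS] by simp
  have "mr_minus TYPE('a) G vs = 2 * ?h"
    unfolding mr_minus_def
  proof (rule Min_eqI)
    \<comment> \<open>\<open>S_minus\<close> may be infinite, but its ranks are bounded by
      \<open>?N\<close>, so \<open>Min\<close> ranges over a finite set.\<close>
    have "V.rank ` (S_minus G vs) \<subseteq> {..?N}"
      using V.rank_le_nc by (auto simp: S_minus_def)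
    then show "finite (V.rank ` (S_minus G vs))" using finite_subset by blast
    show "2 * ?h \<in> V.rank ` (S_minus G vs)" using AS rA by (intro image_eqI[of _ _ A]) simp_all
  qed (use lower in blast)
  then show ?thesis unfolding m by (auto elim!: evenE oddE)
qed

end
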